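(* Let $\mu\ge 0$ and let $K_n^\mu$ ($n\ge 1$) be the operators $$K_n^\mu(f;x)=\frac{1}{Q(1)\,e_\mu(nx)}\sum_{i=0}^\infty \frac{q_i(nx)}{\gamma_\mu(i)}\, f\!\left(\frac{i+2\mu\theta_i}{n}\right)$$ built from a Dunkl-Appell polynomial set $(q_i)$ with generating function $Q(t)e_\mu(xt)$, as described in the context. Let $\psi\in C[0,\infty)$ and let $a$ be a positive real number. Then $$\left|K_n^\mu(\psi;x)-\psi(x)\right|\le \frac34\left(2+a+s^2\right)w_2(\psi;s)+\frac{2s^2}{a}\,\|\psi\|,\qquad x\in[0,a],$$ where $s=\sqrt[4]{\Omega_2}$, $\Omega_2=K_n^\mu\bigl((\xi-x)^2;x\bigr)$, $\|\psi\|=\sup_{x\in[0,\infty)}|\psi(x)|$, and $w_2$ is the second-order modulus of continuity.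
   Context: Let $\mu\ge 0$. Put $\theta_i=0$ for even $i$ and $\theta_i=1$ for odd $i$ ($i\in\mathbb{N}_0$). Define $$\gamma_\mu(2i)=\frac{2^{2i}\,i!\,\Gamma(i+\mu+1/2)}{\Gamma(\mu+1/2)},\qquad \gamma_\mu(2i+1)=\frac{2^{2i+1}\,i!\,\Gamma(i+\mu+3/2)}{\Gamma(\mu+1/2)},$$ so that $\gamma_\mu(i+1)=(i+1+2\mu\theta_{i+1})\gamma_\mu(i)$, and let $e_\mu(x)=\sum_{i=0}^\infty x^i/\gamma_\mu(i)$. A Dunkl-Appell polynomial set $(q_i)$ is one generated by $Q(t)e_\mu(xt)=\sum_{i=0}^\infty \frac{q_i(x)}{\gamma_\mu(i)}t^i$, where $Q(t)=\sum_{i=0}^\infty \frac{a_i}{\gamma_\mu(i)}t^i$ with $a_0\ne0$; equivalently $q_i(x)=\sum_{j=0}^i \frac{\gamma_\mu(i)}{\gamma_\mu(j)\gamma_\mu(i-j)}a_{i-j}x^j$, the sequence $(a_j)$ not depending on $i$. In $K_n^\mu((\xi-x)^2;x)$ the operator is applied to the function $\xi\mapsto(\xi-x)^2$ and evaluated at the point $x$; thus $\Omega_2$ and $s$ depend on $n$ and $x$. The second-order modulus of continuity is, in its standard form, $w_2(\psi;\delta)=\sup_{0\le h\le\delta}\ \sup_{x\in[0,\infty)}|\psi(x+2h)-2\psi(x+h)+\psi(x)|$ for $\delta\ge0$.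
   Formalization: It is additionally assumed that q_i(y)/Q(1) ≥ 0 for all i and y ≥ 0 (positive operators), without which the inequality can fail at x = 0 or s be undefined; also that the series for Q(1) converges to a nonzero value and the series defining Ω_2 converges. *)

theory Defs
  imports "HOL-Analysis.Analysis" "HOL-Computational_Algebra.Polynomial"
    "HOL-Computational_Algebra.Formal_Power_Series"
begin

definition dunkl_theta :: "nat \<Rightarrow> real" where
  "dunkl_theta i = (if even i then 0 else 1)"

definition dunkl_gamma :: "real \<Rightarrow> nat \<Rightarrow> real" where
  "dunkl_gamma \<mu> k =
     (if even k
      then 2 ^ k * fact (k div 2) * Gamma (real (k div 2) + \<mu> + 1/2) / Gamma (\<mu> + 1/2)
      else 2 ^ k * fact (k div 2) * Gamma (real (k div 2) + \<mu> + 3/2) / Gamma (\<mu> + 1/2))"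

definition dunkl_exp :: "real \<Rightarrow> real \<Rightarrow> real" where
  "dunkl_exp \<mu> x = (\<Sum>i. x ^ i / dunkl_gamma \<mu> i)"

definition dunkl_Q :: "real \<Rightarrow> (nat \<Rightarrow> real) \<Rightarrow> real \<Rightarrow> real" where
  "dunkl_Q \<mu> c t = (\<Sum>i. c i / dunkl_gamma \<mu> i * t ^ i)"

text \<open>The generating relation \<open>Q(t) e\<^sub>\<mu>(xt) = (\<Sum>i. q\<^sub>i(x) t\<^sup>i / \<gamma>\<^sub>\<mu>(i))\<close>
  is read as an identity of formal power series in \<open>t\<close>, for every real \<open>x\<close>;
  \<open>c\<close> is the coefficient sequence of \<open>Q\<close>.\<close>

definition dunkl_appell :: "real \<Rightarrow> (nat \<Rightarrow> real) \<Rightarrow> (nat \<Rightarrow> real poly) \<Rightarrow> bool" where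
  "dunkl_appell \<mu> c q \<longleftrightarrow>
     c 0 \<noteq> 0 \<and>
     (\<forall>x. Abs_fps (\<lambda>i. c i / dunkl_gamma \<mu> i) * Abs_fps (\<lambda>i. x ^ i / dunkl_gamma \<mu> i)
          = Abs_fps (\<lambda>i. poly (q i) x / dunkl_gamma \<mu> i))"

definition dunkl_term ::
    "real \<Rightarrow> (nat \<Rightarrow> real poly) \<Rightarrow> nat \<Rightarrow> (real \<Rightarrow> real) \<Rightarrow> real \<Rightarrow> nat \<Rightarrow> real" where
  "dunkl_term \<mu> q n f x i =
     poly (q i) (real n * x) / dunkl_gamma \<mu> i * f ((real i + 2 * \<mu> * dunkl_theta i) / real n)"

definition dunkl_K ::
    "real \<Rightarrow> (nat \<Rightarrow> real) \<Rightarrow> (nat \<Rightarrow> real poly) \<Rightarrow> nat \<Rightarrow> (real \<Rightarrow> real) \<Rightarrow> real \<Rightarrow> real" where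
  "dunkl_K \<mu> c q n f x =
     1 / (dunkl_Q \<mu> c 1 * dunkl_exp \<mu> (real n * x)) * (\<Sum>i. dunkl_term \<mu> q n f x i)"

text \<open>The supremum norm and the modulus are extended-real valued: they are \<open>\<infinity>\<close>, rather than
  an unspecified real, when the supremum is not finite.\<close>

definition sup_norm :: "(real \<Rightarrow> real) \<Rightarrow> ereal" where
  "sup_norm f = (SUP x\<in>{0..}. ereal \<bar>f x\<bar>)"

definition modulus2 :: "(real \<Rightarrow> real) \<Rightarrow> real \<Rightarrow> ereal" where
  "modulus2 f \<delta> =
     (SUP h\<in>{0..\<delta>}. SUP x\<in>{0..}. ereal \<bar>f (x + 2 * h) - 2 * f (x + h) + f x\<bar>)"

lemma dunkl_gamma_0: "\<mu> \<ge> 0 \<Longrightarrow> dunkl_gamma \<mu> 0 = 1"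
  using Gamma_real_pos[of "\<mu> + 1/2"] by (simp add: dunkl_gamma_def less_imp_neq[symmetric])

lemma dunkl_gamma_Suc:
  assumes "\<mu> \<ge> 0"
  shows "dunkl_gamma \<mu> (Suc i) = (real i + 1 + 2 * \<mu> * dunkl_theta (Suc i)) * dunkl_gamma \<mu> i"
proof (cases "even i")
  case True
  then obtain k where k: "i = 2 * k" by blast
  have "Gamma (real k + \<mu> + 1/2 + 1) = (real k + \<mu> + 1/2) * Gamma (real k + \<mu> + 1/2)"
    using assms by (intro Gamma_plus1) (auto elim!: nonpos_Ints_cases)
  then have "Gamma (real k + \<mu> + 3/2) = (real k + \<mu> + 1/2) * Gamma (real k + \<mu> + 1/2)"
    by (simp add: add.assoc)
  then show ?thesis
    by (simp add: k dunkl_gamma_def dunkl_theta_def algebra_simps)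
next
  case False
  then obtain k where k: "i = 2 * k + 1" by (elim oddE)
  have "real (Suc k) + \<mu> + 1/2 = real k + \<mu> + 3/2" by simp
  then show ?thesis
    by (simp add: k dunkl_gamma_def dunkl_theta_def algebra_simps)
qed

lemma dunkl_gamma_pos: "\<mu> \<ge> 0 \<Longrightarrow> dunkl_gamma \<mu> i > 0"
  by (induction i) (auto simp: dunkl_gamma_0 dunkl_gamma_Suc dunkl_theta_def intro!: mult_pos_pos)

lemma dunkl_appell_iff:
  assumes "\<mu> \<ge> 0"
  shows "dunkl_appell \<mu> c q \<longleftrightarrow> c 0 \<noteq> 0 \<and>
    (\<forall>i x. poly (q i) x =
       (\<Sum>j\<le>i. dunkl_gamma \<mu> i / (dunkl_gamma \<mu> j * dunkl_gamma \<mu> (i - j)) * c (i - j) * x ^ j))"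
proof -
  define g where "g = dunkl_gamma \<mu>"
  have g: "g i \<noteq> 0" for i
    using dunkl_gamma_pos[OF assms, of i] by (simp add: g_def)
  have "fps_nth (Abs_fps (\<lambda>i. c i / g i) * Abs_fps (\<lambda>i. x ^ i / g i)) i
      = (\<Sum>j\<le>i. g i / (g j * g (i - j)) * c (i - j) * x ^ j) / g i" for x i
    using g
    by (subst mult.commute, subst fps_mult_nth)
      (auto simp: atLeast0AtMost sum_divide_distrib intro!: sum.cong)
  then show ?thesis
    using g unfolding dunkl_appell_def g_def[symmetric] fps_eq_iff by (auto simp: field_simps)
qed

end

theory Submission
  imports Defs
begin

text \<open>
  It suffices to bound \<open>\<psi>(t) - \<psi>(x)\<close> pointwise by a linear term plus a quadratic one and to
  sum against the weights of \<open>K\<close>, which are nonnegative with total mass 1. With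
  \<open>m = (\<psi>(x + s) - \<psi>(x)) / s\<close> we have
  \<open>\<bar>\<psi>(t) - \<psi>(x) - m (t - x)\<bar> \<le> (3/2 + 3/4 ((t - x) / s)\<^sup>2) w\<^sub>2(\<psi>; s)\<close>: on an interval of length
  \<open>2s\<close> Whitney's theorem gives a slope for which the oscillation of \<open>\<psi>\<close> minus a linear function is
  at most \<open>w\<^sub>2\<close>, and the values at \<open>x + k s\<close> are controlled by summing second differences.
  The same summation up to \<open>k s \<ge> a\<close> gives \<open>\<bar>m\<bar> \<le> 2 \<parallel>\<psi>\<parallel> / a + a w\<^sub>2 / (2 s\<^sup>2)\<close>.
  This avoids smoothing \<open>\<psi>\<close> near the endpoint 0.
\<close>

section \<open>Whitney's theorem for approximation by linear functions\<close>

text \<open>At a minimum both one-sided increments are nonnegative and their sum is a second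
  difference, so neither exceeds \<open>w\<close>. Hence a minimum cannot have points higher by more
  than \<open>w\<close> on both sides: reflecting the nearer one stays in the interval. Maxima are
  dual. Each case exhibits such a forbidden extremum.\<close>

lemma no_rise_with_max_before_min:
  fixes e :: "real \<Rightarrow> real"
  assumes cont: "continuous_on {u..v} e" and "w \<ge> 0"
    and diff2: "\<And>y d. 0 \<le> d \<Longrightarrow> u \<le> y - d \<Longrightarrow> y + d \<le> v \<Longrightarrow> \<bar>e (y + d) - 2 * e y + e (y - d)\<bar> \<le> w"
    and max: "\<And>t. t \<in> {u..v} \<Longrightarrow> e t \<le> e \<alpha>" and min: "\<And>t. t \<in> {u..v} \<Longrightarrow> e \<beta> \<le> e t"
    and \<alpha>\<beta>: "u \<le> \<alpha>" "\<alpha> < \<beta>" "\<beta> \<le> v" and osc: "e \<alpha> - e \<beta> > w"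
    and rise: "u \<le> b" "b < a" "a \<le> v" "e a - e b > w"
  shows False
proof -
  have mid: "2 * e y - e (y + d) - e (y - d) \<le> w" "e (y + d) + e (y - d) - 2 * e y \<le> w"
    if "0 \<le> d" "u \<le> y - d" "y + d \<le> v" for y d
    using diff2[OF that] by linarith+
  \<comment> \<open>The forbidden extremum is \<beta>, flanked by \<alpha> and \<open>a\<close>; or
    \<alpha>, flanked by \<open>b\<close> and \<beta>; or else a new minimum between \<alpha> and
    \<open>a\<close>.\<close>
  consider "a > \<beta>" | "b < \<alpha>" | "\<alpha> \<le> b" "a \<le> \<beta>" by linarith
  then show False
  proof cases
    case 1
    show False
    proof (cases "\<beta> - \<alpha> \<le> a - \<beta>")
      case True
      then show False
        using mid(2)[of "\<beta> - \<alpha>" \<beta>] min[of "\<beta> + (\<beta> - \<alpha>)"] \<alpha>\<beta> osc rise by simp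
    next
      case False
      then show False
        using mid(2)[of "a - \<beta>" \<beta>] min[of "\<beta> - (a - \<beta>)"] min[of b] \<alpha>\<beta> rise 1 by simp
    qed
  next
    case 2
    show False
    proof (cases "\<beta> - \<alpha> \<le> \<alpha> - b")
      case True
      then show False
        using mid(1)[of "\<beta> - \<alpha>" \<alpha>] max[of "\<alpha> - (\<beta> - \<alpha>)"] \<alpha>\<beta> osc rise by simp
    next
      case False
      then show False
        using mid(1)[of "\<alpha> - b" \<alpha>] max[of "\<alpha> + (\<alpha> - b)"] max[of a] \<alpha>\<beta> rise 2 by simp
    qed
  next
    case 3
    \<comment> \<open>The minimum over \<open>{\<alpha>..a}\<close> lies more than \<open>w\<close>
      below both endpoints, because \<open>e \<alpha> \<ge> e a\<close>.\<close>
    have "continuous_on {\<alpha>..a} e" using cont 3 \<alpha>\<beta> rise by (auto elim: continuous_on_subset)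
    then obtain b' where b': "b' \<in> {\<alpha>..a}" "\<And>t. t \<in> {\<alpha>..a} \<Longrightarrow> e b' \<le> e t"
      using continuous_attains_inf[of "{\<alpha>..a}" e] 3 rise by auto
    have fall: "e a - e b' > w" using b'(2)[of b] 3 rise by simp
    then have "b' < a" using b'(1) \<open>w \<ge> 0\<close> by (cases "b' = a") auto
    have fall': "e \<alpha> - e b' > w" using fall max[of a] rise by simp
    show False
    proof (cases "b' - \<alpha> \<le> a - b'")
      case True
      then show False
        using mid(2)[of "b' - \<alpha>" b'] b'(2)[of "b' + (b' - \<alpha>)"] b'(1) \<alpha>\<beta> fall' rise by simp
    next
      case False
      then show False
        using mid(2)[of "a - b'" b'] b'(2)[of "b' - (a - b')"] b'(1) \<alpha>\<beta> fall rise \<open>b' < a\<close> by simp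
    qed
  qed
qed

text \<open>Whichever global extremum comes first, the previous lemma excludes the rise, or, applied
  to \<open>- e\<close>, the fall.\<close>

lemma no_rise_and_fall:
  fixes e :: "real \<Rightarrow> real"
  assumes cont: "continuous_on {u..v} e" and "w \<ge> 0"
    and diff2: "\<And>y d. 0 \<le> d \<Longrightarrow> u \<le> y - d \<Longrightarrow> y + d \<le> v \<Longrightarrow> \<bar>e (y + d) - 2 * e y + e (y - d)\<bar> \<le> w"
    and rise: "u \<le> b" "b < a" "a \<le> v" "e a - e b > w"
    and fall: "u \<le> a'" "a' < b'" "b' \<le> v" "e a' - e b' > w"
  shows False
proof -
  have ne: "{u..v} \<noteq> {}" using rise by auto
  obtain \<alpha> where \<alpha>: "\<alpha> \<in> {u..v}" "\<And>t. t \<in> {u..v} \<Longrightarrow> e t \<le> e \<alpha>"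
    using continuous_attains_sup[OF compact_Icc ne cont] by auto
  obtain \<beta> where \<beta>: "\<beta> \<in> {u..v}" "\<And>t. t \<in> {u..v} \<Longrightarrow> e \<beta> \<le> e t"
    using continuous_attains_inf[OF compact_Icc ne cont] by auto
  have osc: "e \<alpha> - e \<beta> > w" using \<alpha>(2)[of a] \<beta>(2)[of b] rise by simp
  then consider "\<alpha> < \<beta>" | "\<beta> < \<alpha>" using \<open>w \<ge> 0\<close> by (cases \<alpha> \<beta> rule: linorder_cases) auto
  then show False
  proof cases
    case 1
    show False
      by (rule no_rise_with_max_before_min[OF cont \<open>w \<ge> 0\<close> diff2 \<alpha>(2) \<beta>(2) _ 1 _ osc rise]) (use \<alpha> \<beta> in auto)
  next
    case 2
    have "\<bar>- e (y + d) - 2 * - e y + - e (y - d)\<bar> \<le> w"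
      if "0 \<le> d" "u \<le> y - d" "y + d \<le> v" for y d
      using diff2[OF that] by linarith
    moreover have "continuous_on {u..v} (\<lambda>t. - e t)" using cont by (intro continuous_intros)
    ultimately show False
      using no_rise_with_max_before_min[of u v "\<lambda>t. - e t" w \<beta> \<alpha> a' b'] \<alpha> \<beta> fall osc \<open>w \<ge> 0\<close> 2 by auto
  qed
qed

text \<open>Slopes that are too small and slopes that are too large form two nonempty open sets of reals,
  which are disjoint by the previous lemma; connectedness yields a slope in neither.\<close>

lemma whitney_linear:
  fixes f :: "real \<Rightarrow> real"
  assumes cont: "continuous_on {u..v} f" and "w \<ge> 0" and "u < v"
    and diff2: "\<And>y d. 0 \<le> d \<Longrightarrow> u \<le> y - d \<Longrightarrow> y + d \<le> v \<Longrightarrow> \<bar>f (y + d) - 2 * f y + f (y - d)\<bar> \<le> w"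
  obtains p where "\<And>s t. s \<in> {u..v} \<Longrightarrow> t \<in> {u..v} \<Longrightarrow> \<bar>f t - f s - p * (t - s)\<bar> \<le> w"
proof -
  define L where "L = {(s, t). u \<le> s \<and> s < t \<and> t \<le> v}"
  define F where "F = (\<Union>(s, t)\<in>L. {p. f t - f s - p * (t - s) < - w})"
  define R where "R = (\<Union>(s, t)\<in>L. {p. f t - f s - p * (t - s) > w})"
  have "(u, v) \<in> L" using \<open>u < v\<close> by (simp add: L_def)
  \<comment> \<open>These slopes make the increment over the whole interval \<open>- w - 1\<close>
    and \<open>w + 1\<close>.\<close>
  then have "((f v - f u + w + 1) / (v - u)) \<in> F" "((f v - f u - w - 1) / (v - u)) \<in> R"
    unfolding F_def R_def using \<open>u < v\<close> by (auto intro!: bexI[of _ "(u, v)"])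
  then have ne: "F \<noteq> {}" "R \<noteq> {}" by auto
  have op: "open F" "open R"
    unfolding F_def R_def by (auto intro!: open_UN open_Collect_less continuous_intros)
  have "F \<inter> R = {}"
  proof (rule ccontr)
    assume "F \<inter> R \<noteq> {}"
    then obtain p s t s' t' where p: "(s, t) \<in> L" "(s', t') \<in> L"
      "f t - f s - p * (t - s) < - w" "f t' - f s' - p * (t' - s') > w"
      by (auto simp: F_def R_def)
    \<comment> \<open>Second differences do not see the linear term, so \<open>e\<close> inherits
      the bound \<open>w\<close> while having both a fall and a rise.\<close>
    define e where "e y = f y - p * y" for y
    have "continuous_on {u..v} e" unfolding e_def by (intro continuous_intros cont)
    moreover have "\<bar>e (y + d) - 2 * e y + e (y - d)\<bar> \<le> w"
      if "0 \<le> d" "u \<le> y - d" "y + d \<le> v" for y d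
      using diff2[OF that] by (simp add: e_def algebra_simps)
    moreover have "u \<le> s'" "s' < t'" "t' \<le> v" "e t' - e s' > w" "u \<le> s" "s < t" "t \<le> v" "e s - e t > w"
      using p by (auto simp: L_def e_def algebra_simps)
    ultimately show False
      using no_rise_and_fall[of u v e w s' t' s t] \<open>w \<ge> 0\<close> by blast
  qed
  then have "F \<union> R \<noteq> UNIV"
    using connectedD[OF connected_UNIV op] ne by auto
  then obtain p where "p \<notin> F" "p \<notin> R" by auto
  then have *: "\<bar>f t - f s - p * (t - s)\<bar> \<le> w" if "u \<le> s" "s < t" "t \<le> v" for s t
    using that by (fastforce simp: F_def R_def L_def)
  show thesis
  proof
    fix s t assume st: "s \<in> {u..v}" "t \<in> {u..v}"
    show "\<bar>f t - f s - p * (t - s)\<bar> \<le> w"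
    proof (cases s t rule: linorder_cases)
      case greater
      then show ?thesis using *[of t s] st by (simp add: algebra_simps)
    qed (use * st \<open>w \<ge> 0\<close> in auto)
  qed
qed

section \<open>Error of linear interpolation in terms of second differences\<close>

text \<open>A finite bound on the second modulus in centred form; a real \<open>w\<close> keeps
  these estimates out of extended-real arithmetic.\<close>

locale second_difference_bound =
  fixes f :: "real \<Rightarrow> real" and h w :: real
  assumes cont: "continuous_on {0..} f" and h: "h > 0"
    and diff2: "\<And>y d. 0 \<le> d \<Longrightarrow> d \<le> h \<Longrightarrow> 0 \<le> y - d \<Longrightarrow> \<bar>f (y + d) - 2 * f y + f (y - d)\<bar> \<le> w"
begin

lemma w_nonneg: "w \<ge> 0"
  using diff2[of 0 0] h by auto

text \<open>The Whitney slope fits both the increment to \<open>t\<close> and the increment to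
  \<open>u + h\<close> up to \<open>w\<close>; exchanging it for the secant slope costs the second
  error times \<open>\<bar>t - u\<bar> / h\<close>.\<close>

lemma near_secant:
  assumes "0 \<le> u" "0 \<le> t" "\<bar>t - u\<bar> \<le> h"
  shows "\<bar>f t - f u - (t - u) / h * (f (u + h) - f u)\<bar> \<le> w * (1 + \<bar>t - u\<bar> / h)"
proof -
  \<comment> \<open>The interval of length \<open>2 * h\<close> from \<open>l\<close> contains
    \<open>u\<close>, \<open>t\<close> and \<open>u + h\<close>, and its centred steps are at most
    \<open>h\<close>.\<close>
  define l where "l = min u t"
  have l: "0 \<le> l" "l \<le> u" "l \<le> t" "u \<le> l + h" "t \<le> l + 2 * h"
    using assms h by (auto simp: l_def)
  have "continuous_on {l..l + 2 * h} f"
    using cont l by (auto elim: continuous_on_subset)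
  moreover have "\<bar>f (y + d) - 2 * f y + f (y - d)\<bar> \<le> w"
    if "0 \<le> d" "l \<le> y - d" "y + d \<le> l + 2 * h" for y d
    using that l by (intro diff2) auto
  ultimately obtain p where
    p: "\<And>s t. s \<in> {l..l + 2 * h} \<Longrightarrow> t \<in> {l..l + 2 * h} \<Longrightarrow> \<bar>f t - f s - p * (t - s)\<bar> \<le> w"
    using whitney_linear[of l "l + 2 * h" f w] w_nonneg h by force
  define A where "A = f t - f u - p * (t - u)"
  define B where "B = f (u + h) - f u - p * h"
  have AB: "\<bar>A\<bar> \<le> w" "\<bar>B\<bar> \<le> w"
    using p[of u t] p[of u "u + h"] l h by (auto simp: A_def B_def)
  have "f t - f u - (t - u) / h * (f (u + h) - f u) = A - (t - u) / h * B"
    using h by (simp add: A_def B_def field_simps)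
  also have "\<bar>\<dots>\<bar> \<le> \<bar>A\<bar> + \<bar>t - u\<bar> / h * \<bar>B\<bar>"
    using abs_triangle_ineq4[of A "(t - u) / h * B"] h by (simp add: abs_mult)
  also have "\<dots> \<le> w + \<bar>t - u\<bar> / h * w"
    using AB h by (intro add_mono mult_left_mono) auto
  finally show ?thesis by (simp add: algebra_simps)
qed

definition remainder :: "real \<Rightarrow> real \<Rightarrow> real" where
  "remainder x t = f t - f x - (f (x + h) - f x) / h * (t - x)"

lemma remainder_base: "remainder x x = 0" "remainder x (x + h) = 0"
  using h by (auto simp: remainder_def)

lemma remainder_diff2:
  "0 \<le> y \<Longrightarrow> \<bar>remainder x (y + 2 * h) - 2 * remainder x (y + h) + remainder x y\<bar> \<le> w"
proof -
  assume "0 \<le> y"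
  define m where "m = (f (x + h) - f x) / h"
  have "remainder x (y + 2 * h) - 2 * remainder x (y + h) + remainder x y
      = f (y + 2 * h) - 2 * f (y + h) + f y"
    unfolding remainder_def m_def[symmetric] by (simp add: algebra_simps)
  then show ?thesis using diff2[of h "y + h"] h \<open>0 \<le> y\<close> by (simp add: add.assoc)
qed

text \<open>The left side of \<open>near_secant\<close> is unchanged by subtracting a linear
  function. The point \<open>u\<close> will be the grid point \<open>x + k h\<close> or
  \<open>x - k h\<close> next to \<open>t\<close>.\<close>

lemma remainder_near:
  assumes "0 \<le> u" "0 \<le> t" "\<bar>t - u\<bar> \<le> h"
  shows "\<bar>remainder x t\<bar> \<le> \<bar>remainder x u\<bar> + w
    + \<bar>t - u\<bar> / h * (\<bar>remainder x (u + h) - remainder x u\<bar> + w)"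
proof -
  define r where "r = (t - u) / h"
  define D where "D = remainder x (u + h) - remainder x u"
  have "f t - f u - r * (f (u + h) - f u)
      = remainder x t - remainder x u - r * D"
    using h by (simp add: remainder_def r_def D_def field_simps)
  moreover have "\<bar>r\<bar> = \<bar>t - u\<bar> / h" using h by (simp add: r_def)
  ultimately have "\<bar>remainder x t - remainder x u - r * D\<bar> \<le> w * (1 + \<bar>r\<bar>)"
    using near_secant[OF assms] unfolding r_def[symmetric] by simp
  then have "\<bar>remainder x t\<bar> \<le> \<bar>remainder x u\<bar> + \<bar>r * D\<bar> + w * (1 + \<bar>r\<bar>)" by linarith
  then show ?thesis
    unfolding D_def[symmetric] \<open>\<bar>r\<bar> = _\<close>[symmetric] by (simp add: abs_mult algebra_simps)
qed

text \<open>The first difference vanishes at \<open>x\<close> and changes by at most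
  \<open>w\<close> per step; the values add up \<open>0 + 1 + ... + (k - 1)\<close>.\<close>

lemma remainder_forward:
  assumes "0 \<le> x"
  shows "\<bar>remainder x (x + real k * h + h) - remainder x (x + real k * h)\<bar> \<le> real k * w"
    and "\<bar>remainder x (x + real k * h)\<bar> \<le> real k * (real k - 1) / 2 * w"
proof -
  show *: "\<bar>remainder x (x + real k * h + h) - remainder x (x + real k * h)\<bar> \<le> real k * w" for k
  proof (induction k)
    case 0
    then show ?case by (simp add: remainder_base)
  next
    case (Suc k)
    have "0 \<le> x + real k * h" using assms h by simp
    from remainder_diff2[OF this, of x] Suc show ?case by (simp add: algebra_simps)
  qed
  show "\<bar>remainder x (x + real k * h)\<bar> \<le> real k * (real k - 1) / 2 * w"
  proof (induction k)
    case 0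
    then show ?case by (simp add: remainder_base)
  next
    case (Suc k)
    then show ?case using *[of k] by (simp add: algebra_simps add_divide_distrib diff_divide_distrib)
  qed
qed

text \<open>As in the forward case, but the remainder vanishes at \<open>x + h\<close> and not
  necessarily at \<open>x - h\<close>, so the values add up \<open>1 + ... + k\<close>.\<close>

lemma remainder_backward:
  assumes "real k * h \<le> x"
  shows "\<bar>remainder x (x - real k * h + h) - remainder x (x - real k * h)\<bar> \<le> real k * w
     \<and> \<bar>remainder x (x - real k * h)\<bar> \<le> real k * (real k + 1) / 2 * w"
  using assms
proof (induction k)
  case 0
  then show ?case by (simp add: remainder_base)
next
  case (Suc k)
  have *: "real k * h \<le> x" "0 \<le> x - real k * h - h" using Suc.prems h by (auto simp: algebra_simps)
  define y where "y = x - real k * h"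
  have "\<bar>remainder x (y + h) - remainder x y\<bar> \<le> real k * w"
    "\<bar>remainder x y\<bar> \<le> real k * (real k + 1) / 2 * w"
    using Suc.IH[OF *(1)] by (auto simp: y_def)
  moreover have "\<bar>remainder x (y + h) - 2 * remainder x y + remainder x (y - h)\<bar> \<le> w"
    using remainder_diff2[OF *(2), of x] by (simp add: y_def algebra_simps)
  ultimately have 1: "\<bar>remainder x y - remainder x (y - h)\<bar> \<le> real k * w + w"
    and 2: "\<bar>remainder x (y - h)\<bar> \<le> real k * (real k + 1) / 2 * w + (real k * w + w)"
    by linarith+
  have 3: "x - real (Suc k) * h = y - h" by (simp add: y_def algebra_simps)
  show ?case
    unfolding 3 using 1 2 by (simp add: algebra_simps add_divide_distrib)
qed

text \<open>With \<open>\<bar>t - x\<bar> / h = k + r\<close>, the grid bounds carry the estimate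
  over \<open>k\<close> steps and \<open>remainder_near\<close> over the last fraction
  \<open>r\<close>. What remains is an inequality between quadratics in \<open>k\<close> and
  \<open>r\<close>.\<close>

lemma remainder_bound:
  assumes "0 \<le> x" "0 \<le> t"
  shows "\<bar>remainder x t\<bar> \<le> (3/2 + 3/4 * ((t - x) / h)\<^sup>2) * w"
proof -
  define z where "z = \<bar>t - x\<bar> / h"
  define k where "k = nat \<lfloor>z\<rfloor>"
  define r where "r = z - real k"
  have "z \<ge> 0" using h by (simp add: z_def)
  then have r: "0 \<le> r" "r < 1" and z: "z = real k + r"
    by (auto simp: r_def k_def) linarith+
  have zh: "\<bar>t - x\<bar> = real k * h + r * h"
    using h by (simp add: z_def z[symmetric] distrib_right[symmetric])
  have rh: "\<bar>r * h\<bar> \<le> h" "\<bar>r * h\<bar> / h = r" using r h by (auto simp: abs_mult)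
  have sq: "((t - x) / h)\<^sup>2 = (real k + r)\<^sup>2"
    using z by (metis abs_div_pos h power2_abs z_def)
  have pos: "0 \<le> 1/2 - r + 3/4 * r\<^sup>2"
  proof -
    have "0 \<le> 3/4 * (r - 2/3)\<^sup>2 + 1/6" by simp
    then show ?thesis by (simp add: power2_eq_square algebra_simps)
  qed
  show ?thesis
  proof (cases "x \<le> t")
    case True
    define u where "u = x + real k * h"
    have tu: "t - u = r * h" using True zh by (simp add: u_def)
    have "\<bar>remainder x t\<bar> \<le> \<bar>remainder x u\<bar> + w + r * (\<bar>remainder x (u + h) - remainder x u\<bar> + w)"
      using remainder_near[of u t x] assms h rh unfolding tu by (simp add: u_def)
    also have "\<dots> \<le> real k * (real k - 1) / 2 * w + w + r * (real k * w + w)"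
      using remainder_forward[OF \<open>0 \<le> x\<close>, of k] r
      by (intro add_mono mult_left_mono) (auto simp: u_def)
    also have "\<dots> = (real k * (real k - 1) / 2 + 1 + r * (real k + 1)) * w"
      by (simp add: algebra_simps)
    also have "\<dots> \<le> (3/2 + 3/4 * (real k + r)\<^sup>2) * w"
    proof (rule mult_right_mono[OF _ w_nonneg])
      have "0 \<le> (real k)\<^sup>2 / 4 + real k / 2 + real k * r / 2" using r by simp
      then show "real k * (real k - 1) / 2 + 1 + r * (real k + 1) \<le> 3/2 + 3/4 * (real k + r)\<^sup>2"
        using pos by (simp add: power2_eq_square algebra_simps diff_divide_distrib)
    qed
    finally show ?thesis by (simp add: sq)
  next
    case False
    define u where "u = x - real k * h"
    have tu: "t - u = - (r * h)" using False zh by (simp add: u_def)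
    \<comment> \<open>Since \<open>t \<ge> 0\<close>, the backward grid does not leave the
      half-line.\<close>
    have "real k * h \<le> x" using False zh assms r h by (smt (verit) mult_nonneg_nonneg)
    then have "\<bar>remainder x t\<bar> \<le> \<bar>remainder x u\<bar> + w + r * (\<bar>remainder x (u + h) - remainder x u\<bar> + w)"
      using remainder_near[of u t x] assms rh unfolding tu by (simp add: u_def)
    also have "\<dots> \<le> real k * (real k + 1) / 2 * w + w + r * (real k * w + w)"
      using remainder_backward[OF \<open>real k * h \<le> x\<close>] r
      by (intro add_mono mult_left_mono) (auto simp: u_def)
    also have "\<dots> = (real k * (real k + 1) / 2 + 1 + r * (real k + 1)) * w"
      by (simp add: algebra_simps)
    also have "\<dots> \<le> (3/2 + 3/4 * (real k + r)\<^sup>2) * w"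
    proof (rule mult_right_mono[OF _ w_nonneg])
      have "0 \<le> 1/2 + (real k)\<^sup>2 / 4 - real k / 2 + real k * r / 2 - r + 3/4 * r\<^sup>2"
      proof -
        \<comment> \<open>For \<open>k \<ge> 2\<close> the mixed terms absorb the negative ones; the
          two small cases are completed squares.\<close>
        consider "k = 0" | "k = 1" | "k \<ge> 2" by linarith
        then show ?thesis
        proof cases
          case 2
          have "0 \<le> 3/4 * (r - 1/3)\<^sup>2 + 1/6" by simp
          then show ?thesis using 2 by (simp add: power2_eq_square algebra_simps)
        next
          case 3
          then have "2 * real k \<le> (real k)\<^sup>2" "2 * r \<le> real k * r"
            using r by (auto simp: power2_eq_square intro!: mult_right_mono)
          moreover have "0 \<le> r\<^sup>2" by simp
          ultimately show ?thesis by linarith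
        qed (use pos in simp)
      qed
      then show "real k * (real k + 1) / 2 + 1 + r * (real k + 1) \<le> 3/2 + 3/4 * (real k + r)\<^sup>2"
        by (simp add: power2_eq_square algebra_simps add_divide_distrib)
    qed
    finally show ?thesis by (simp add: sq)
  qed
qed

text \<open>Over \<open>k\<close> steps the slope is an increment of \<open>f\<close>, at most
  \<open>2 * M\<close>, up to the grid remainder. Rounding \<open>a / h\<close> up gives both
  \<open>a \<le> k h\<close> for the first term and \<open>(k - 1) h \<le> a\<close> for the
  second.\<close>

lemma secant_slope_bound:
  assumes "0 \<le> x" "a > 0" and M: "\<And>t. 0 \<le> t \<Longrightarrow> \<bar>f t\<bar> \<le> M"
  shows "\<bar>(f (x + h) - f x) / h\<bar> \<le> 2 * M / a + a / (2 * h\<^sup>2) * w"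
proof -
  define m where "m = (f (x + h) - f x) / h"
  define k where "k = nat \<lceil>a / h\<rceil>"
  have pos: "a / h > 0" using assms h by simp
  then have "a / h \<le> real k" "real k < a / h + 1" by (auto simp: k_def) linarith
  then have k: "a \<le> real k * h" "(real k - 1) * h \<le> a" "real k > 0"
    using h \<open>a > 0\<close> pos by (auto simp: field_simps intro!: gr0I)
  have "M \<ge> 0" using M[of 0] by simp
  have "m * (real k * h) = f (x + real k * h) - f x - remainder x (x + real k * h)"
    by (simp add: remainder_def m_def)
  then have "\<bar>m * (real k * h)\<bar> \<le> 2 * M + real k * (real k - 1) / 2 * w"
    using M[of x] M[of "x + real k * h"] remainder_forward(2)[OF \<open>0 \<le> x\<close>, of k] assms(1) h
    by (smt (verit) mult_nonneg_nonneg of_nat_0_le_iff)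
  then have "\<bar>m\<bar> \<le> (2 * M + real k * (real k - 1) / 2 * w) / (real k * h)"
    using k h by (simp add: abs_mult pos_le_divide_eq)
  also have "\<dots> = 2 * M / (real k * h) + (real k - 1) * h / (2 * h\<^sup>2) * w"
    using k h by (simp add: field_simps power2_eq_square)
  also have "\<dots> \<le> 2 * M / a + a / (2 * h\<^sup>2) * w"
    using k h \<open>M \<ge> 0\<close> \<open>a > 0\<close> w_nonneg
    by (intro add_mono divide_left_mono mult_right_mono divide_right_mono) auto
  finally show ?thesis by (simp add: m_def)
qed

end

section \<open>Averaging against probability weights\<close>

lemma bounded_deviation:
  fixes W \<xi> :: "nat \<Rightarrow> real"
  assumes f: "second_difference_bound f s w" and M: "\<And>t. 0 \<le> t \<Longrightarrow> \<bar>f t\<bar> \<le> M"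
    and W: "\<And>i. W i \<ge> 0" "W sums 1" and \<xi>: "\<And>i. \<xi> i \<ge> 0"
    and second_moment: "(\<lambda>i. W i * (\<xi> i - x)\<^sup>2) sums s ^ 4"
    and "a > 0" "x \<ge> 0"
  shows "summable (\<lambda>i. W i * f (\<xi> i))"
    and "\<bar>(\<Sum>i. W i * f (\<xi> i)) - f x\<bar> \<le> 3/4 * (2 + a + s\<^sup>2) * w + 2 * s\<^sup>2 / a * M"
proof -
  interpret second_difference_bound f s w by (rule f)
  define m where "m = (f (x + s) - f x) / s"
  define A where "A = \<bar>m\<bar> * s\<^sup>2 / 2 + 3/2 * w"
  define B where "B = \<bar>m\<bar> / (2 * s\<^sup>2) + 3/4 * w / s\<^sup>2"
  have bound: "\<bar>f t - f x\<bar> \<le> A + B * (t - x)\<^sup>2" if "t \<ge> 0" for t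
  proof -
    \<comment> \<open>This replaces Cauchy-Schwarz: with second moment \<open>s ^ 4\<close> it
      averages to a first absolute moment of at most \<open>s\<^sup>2\<close>, and needs only the
      second-moment series.\<close>
    have "0 \<le> (s\<^sup>2 - \<bar>t - x\<bar>)\<^sup>2 / (2 * s\<^sup>2)" by simp
    also have "\<dots> = s\<^sup>2 / 2 + (t - x)\<^sup>2 / (2 * s\<^sup>2) - \<bar>t - x\<bar>"
      using h by (simp add: power2_diff field_simps)
    finally have "\<bar>t - x\<bar> \<le> s\<^sup>2 / 2 + (t - x)\<^sup>2 / (2 * s\<^sup>2)" by simp
    then have "\<bar>m * (t - x)\<bar> \<le> \<bar>m\<bar> * (s\<^sup>2 / 2 + (t - x)\<^sup>2 / (2 * s\<^sup>2))"
      unfolding abs_mult by (intro mult_left_mono) auto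
    moreover have "f t - f x = remainder x t + m * (t - x)"
      by (simp add: remainder_def m_def)
    ultimately have "\<bar>f t - f x\<bar> \<le> (3/2 + 3/4 * ((t - x) / s)\<^sup>2) * w
        + \<bar>m\<bar> * (s\<^sup>2 / 2 + (t - x)\<^sup>2 / (2 * s\<^sup>2))"
      using remainder_bound[OF \<open>x \<ge> 0\<close> that] by linarith
    then show ?thesis by (simp add: A_def B_def power_divide algebra_simps)
  qed
  have majorant: "(\<lambda>i. A * W i + B * (W i * (\<xi> i - x)\<^sup>2)) sums (A * 1 + B * s ^ 4)"
    by (intro sums_add sums_mult W second_moment)
  have le: "norm (W i * f (\<xi> i) - W i * f x) \<le> A * W i + B * (W i * (\<xi> i - x)\<^sup>2)" for i
  proof -
    have "norm (W i * f (\<xi> i) - W i * f x) = W i * \<bar>f (\<xi> i) - f x\<bar>"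
      using W(1)[of i] by (simp add: abs_mult flip: right_diff_distrib)
    also have "\<dots> \<le> W i * (A + B * (\<xi> i - x)\<^sup>2)"
      by (intro mult_left_mono bound \<xi> W)
    finally show ?thesis by (simp add: algebra_simps)
  qed
  have diff: "summable (\<lambda>i. W i * f (\<xi> i) - W i * f x)"
    using le by (intro summable_comparison_test'[OF sums_summable[OF majorant]])
  have const: "(\<lambda>i. W i * f x) sums f x" using sums_mult2[OF W(2), of "f x"] by simp
  have "(\<lambda>i. (W i * f (\<xi> i) - W i * f x) + W i * f x)
      sums ((\<Sum>i. W i * f (\<xi> i) - W i * f x) + f x)"
    by (intro sums_add summable_sums[OF diff] const)
  then have sums: "(\<lambda>i. W i * f (\<xi> i)) sums ((\<Sum>i. W i * f (\<xi> i) - W i * f x) + f x)" by simp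
  then show "summable (\<lambda>i. W i * f (\<xi> i))" by (rule sums_summable)
  from sums have "(\<Sum>i. W i * f (\<xi> i)) - f x = (\<Sum>i. W i * f (\<xi> i) - W i * f x)"
    by (simp add: sums_iff)
  also have "\<bar>\<dots>\<bar> \<le> (\<Sum>i. A * W i + B * (W i * (\<xi> i - x)\<^sup>2))"
    using norm_suminf_le[OF le sums_summable[OF majorant]] by simp
  also have "\<dots> = A + B * s ^ 4" using majorant by (simp add: sums_iff)
  also have "\<dots> = 3/2 * w + 3/4 * s\<^sup>2 * w + \<bar>m\<bar> * s\<^sup>2"
    using h by (simp add: A_def B_def field_simps power2_eq_square power4_eq_xxxx)
  also have "\<dots> \<le> 3/2 * w + 3/4 * s\<^sup>2 * w + (2 * M / a + a / (2 * s\<^sup>2) * w) * s\<^sup>2"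
    using secant_slope_bound[OF \<open>x \<ge> 0\<close> \<open>a > 0\<close> M]
    by (intro add_left_mono mult_right_mono) (auto simp: m_def)
  also have "\<dots> = 3/2 * w + 3/4 * s\<^sup>2 * w + a / 2 * w + 2 * s\<^sup>2 / a * M"
    using h by (simp add: field_simps)
  \<comment> \<open>The only loss here is \<open>a / 2 \<le> 3/4 * a\<close>.\<close>
  also have "\<dots> \<le> 3/4 * (2 + a + s\<^sup>2) * w + 2 * s\<^sup>2 / a * M"
    using w_nonneg \<open>a > 0\<close> by (simp add: algebra_simps)
  finally show "\<bar>(\<Sum>i. W i * f (\<xi> i)) - f x\<bar> \<le> 3/4 * (2 + a + s\<^sup>2) * w + 2 * s\<^sup>2 / a * M" .
qed

section \<open>Convergence of the Dunkl series and the generating relation\<close>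

lemma fact_le_dunkl_gamma: "\<mu> \<ge> 0 \<Longrightarrow> fact i \<le> dunkl_gamma \<mu> i"
proof (induction i)
  case (Suc i)
  have "fact (Suc i) = (real i + 1) * fact i" by simp
  also have "\<dots> \<le> (real i + 1 + 2 * \<mu> * dunkl_theta (Suc i)) * dunkl_gamma \<mu> i"
    using Suc by (intro mult_mono) (auto simp: dunkl_theta_def)
  finally show ?case using Suc.prems by (simp add: dunkl_gamma_Suc)
qed (simp add: dunkl_gamma_0)

lemma summable_dunkl_exp:
  assumes "\<mu> \<ge> 0"
  shows "summable (\<lambda>i. \<bar>x ^ i / dunkl_gamma \<mu> i\<bar>)"
proof (rule summable_comparison_test')
  show "summable (\<lambda>i. \<bar>x\<bar> ^ i / fact i)"
    using summable_exp[of "\<bar>x\<bar>"] by (simp add: divide_inverse mult.commute)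
  show "norm \<bar>x ^ i / dunkl_gamma \<mu> i\<bar> \<le> \<bar>x\<bar> ^ i / fact i" for i
    using fact_le_dunkl_gamma[OF assms, of i] dunkl_gamma_pos[OF assms, of i]
    by (simp add: power_abs frac_le)
qed

lemma dunkl_exp_pos:
  assumes "\<mu> \<ge> 0" "x \<ge> 0"
  shows "dunkl_exp \<mu> x > 0"
  unfolding dunkl_exp_def
proof (rule suminf_pos2[of _ 0])
  show "summable (\<lambda>i. x ^ i / dunkl_gamma \<mu> i)"
    using summable_dunkl_exp[OF assms(1)] by (rule summable_rabs_cancel)
qed (use assms in \<open>auto simp: dunkl_gamma_0 less_imp_le[OF dunkl_gamma_pos]\<close>)

text \<open>Turns the formal generating relation into a convergent one at \<open>t = 1\<close>,
  which gives the weights total mass 1.\<close>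

lemma appell_sums:
  assumes "\<mu> \<ge> 0" and ap: "dunkl_appell \<mu> c q" and "summable (\<lambda>i. c i / dunkl_gamma \<mu> i)"
    and nonneg: "\<And>i y. y \<ge> 0 \<Longrightarrow> poly (q i) y / dunkl_Q \<mu> c 1 \<ge> 0" and "dunkl_Q \<mu> c 1 \<noteq> 0"
  shows "(\<lambda>i. poly (q i) y / dunkl_gamma \<mu> i) sums (dunkl_Q \<mu> c 1 * dunkl_exp \<mu> y)"
proof -
  \<comment> \<open>At \<open>y = 0\<close> the positivity assumption says that the coefficients of \<open>Q\<close> have constant sign,
    so their series converges absolutely and the Cauchy product applies.\<close>
  have "poly (q i) 0 = c i" for i
  proof -
    have "poly (q i) 0 = (\<Sum>j\<le>i. if j = 0 then c i else 0)"
      using ap dunkl_gamma_pos[OF \<open>\<mu> \<ge> 0\<close>, of i]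
      unfolding dunkl_appell_iff[OF \<open>\<mu> \<ge> 0\<close>]
      by (auto simp: dunkl_gamma_0[OF \<open>\<mu> \<ge> 0\<close>] intro!: sum.cong)
    then show ?thesis by simp
  qed
  then have c: "c i / dunkl_Q \<mu> c 1 \<ge> 0" for i using nonneg[of 0 i] by simp
  have "\<bar>c i / dunkl_gamma \<mu> i\<bar> = \<bar>dunkl_Q \<mu> c 1\<bar> * (c i / dunkl_gamma \<mu> i / dunkl_Q \<mu> c 1)" for i
  proof -
    have "\<bar>c i\<bar> = \<bar>dunkl_Q \<mu> c 1\<bar> * (c i / dunkl_Q \<mu> c 1)"
      using abs_of_nonneg[OF c[of i]] \<open>dunkl_Q \<mu> c 1 \<noteq> 0\<close> by (simp add: field_simps abs_divide)
    then show ?thesis using dunkl_gamma_pos[OF \<open>\<mu> \<ge> 0\<close>, of i] by (simp add: abs_divide)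
  qed
  then have "summable (\<lambda>i. norm (c i / dunkl_gamma \<mu> i))"
    unfolding real_norm_def by (simp only:) (intro summable_mult summable_divide assms(3))
  moreover have "summable (\<lambda>i. norm (y ^ i / dunkl_gamma \<mu> i))"
    using summable_dunkl_exp[OF \<open>\<mu> \<ge> 0\<close>] by simp
  ultimately have "(\<lambda>k. \<Sum>i\<le>k. c i / dunkl_gamma \<mu> i * (y ^ (k - i) / dunkl_gamma \<mu> (k - i)))
      sums (dunkl_Q \<mu> c 1 * dunkl_exp \<mu> y)"
    unfolding dunkl_Q_def dunkl_exp_def power_one mult_1_right by (rule Cauchy_product_sums)
  moreover have "(\<Sum>i\<le>k. c i / dunkl_gamma \<mu> i * (y ^ (k - i) / dunkl_gamma \<mu> (k - i)))
      = poly (q k) y / dunkl_gamma \<mu> k" for k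
  proof -
    have "fps_nth (Abs_fps (\<lambda>i. c i / dunkl_gamma \<mu> i) * Abs_fps (\<lambda>i. y ^ i / dunkl_gamma \<mu> i)) k
        = poly (q k) y / dunkl_gamma \<mu> k"
      using ap by (simp add: dunkl_appell_def)
    then show ?thesis by (simp add: fps_mult_nth atLeast0AtMost)
  qed
  ultimately show ?thesis by simp
qed

section \<open>Extended-real modulus and norm\<close>

lemma ereal_exhaust_nonneg:
  assumes "0 \<le> (e::ereal)" "e \<noteq> \<infinity>"
  obtains r where "e = ereal r" "r \<ge> 0"
  using assms by (cases e) auto

lemma modulus2_upper:
  assumes "0 \<le> d" "d \<le> \<delta>" "0 \<le> y - d"
  shows "ereal \<bar>f (y + d) - 2 * f y + f (y - d)\<bar> \<le> modulus2 f \<delta>"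
  unfolding modulus2_def using assms
  by (intro SUP_upper2[of d] SUP_upper2[of "y - d"]) (auto simp: algebra_simps)

lemma modulus2_nonneg: "\<delta> \<ge> 0 \<Longrightarrow> modulus2 f \<delta> \<ge> 0"
  by (rule order_trans[OF _ modulus2_upper[of 0 \<delta> 0]]) (auto simp: zero_ereal_def)

lemma sup_norm_upper: "y \<ge> 0 \<Longrightarrow> ereal \<bar>f y\<bar> \<le> sup_norm f"
  unfolding sup_norm_def by (rule SUP_upper) auto

lemma sup_norm_nonneg: "sup_norm f \<ge> 0"
  by (rule order_trans[OF _ sup_norm_upper[of 0]]) (auto simp: zero_ereal_def)

section \<open>The estimate for the operators\<close>

theorem theorem4:
  fixes \<mu> a x \<Omega>2 s :: real and n :: nat and c :: "nat \<Rightarrow> real" and q :: "nat \<Rightarrow> real poly"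
    and \<psi> :: "real \<Rightarrow> real"
  assumes "\<mu> \<ge> 0" and "n \<ge> 1"
    and "dunkl_appell \<mu> c q"
    and "summable (\<lambda>i. c i / dunkl_gamma \<mu> i)" and "dunkl_Q \<mu> c 1 \<noteq> 0"
    and "\<And>i y. y \<ge> 0 \<Longrightarrow> poly (q i) y / dunkl_Q \<mu> c 1 \<ge> 0"
    and "continuous_on {0..} \<psi>"
    and "a > 0" and "x \<in> {0..a}"
    and "summable (dunkl_term \<mu> q n (\<lambda>\<xi>. (\<xi> - x)\<^sup>2) x)"
    and "\<Omega>2 = dunkl_K \<mu> c q n (\<lambda>\<xi>. (\<xi> - x)\<^sup>2) x"
    and "s = root 4 \<Omega>2"
  shows "ereal \<bar>dunkl_K \<mu> c q n \<psi> x - \<psi> x\<bar>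
           \<le> ereal (3/4 * (2 + a + s\<^sup>2)) * modulus2 \<psi> s + ereal (2 * s\<^sup>2 / a) * sup_norm \<psi>"
proof -
  define C where "C = dunkl_Q \<mu> c 1 * dunkl_exp \<mu> (real n * x)"
  define W where "W i = poly (q i) (real n * x) / dunkl_gamma \<mu> i / C" for i
  define \<xi> where "\<xi> i = (real i + 2 * \<mu> * dunkl_theta i) / real n" for i
  have x: "0 \<le> x" "0 \<le> real n * x" using assms(9) by auto
  have e: "dunkl_exp \<mu> (real n * x) > 0" using dunkl_exp_pos assms(1) x by blast
  then have "C \<noteq> 0" using assms(5) by (simp add: C_def)
  \<comment> \<open>\<open>C\<close> may be negative; the sign of \<open>dunkl_Q \<mu> c 1\<close>
    cancels against that of the polynomial.\<close>
  have W_nonneg: "W i \<ge> 0" for i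
  proof -
    have "0 \<le> poly (q i) (real n * x) / dunkl_Q \<mu> c 1 / (dunkl_gamma \<mu> i * dunkl_exp \<mu> (real n * x))"
      by (rule divide_nonneg_pos[OF assms(6)[OF x(2)] mult_pos_pos[OF dunkl_gamma_pos[OF assms(1)] e]])
    also have "\<dots> = W i" by (simp add: W_def C_def mult_ac)
    finally show ?thesis .
  qed
  have "(\<lambda>i. poly (q i) (real n * x) / dunkl_gamma \<mu> i) sums C"
    unfolding C_def by (rule appell_sums[OF assms(1,3,4,6,5)])
  then have "(\<lambda>i. W i) sums (C / C)"
    unfolding W_def by (rule sums_divide)
  then have W_sums: "W sums 1" using \<open>C \<noteq> 0\<close> by simp
  have \<xi>: "\<xi> i \<ge> 0" for i using assms(1) by (simp add: \<xi>_def dunkl_theta_def)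
  have tm: "dunkl_term \<mu> q n f x i = C * (W i * f (\<xi> i))" for f i
    using \<open>C \<noteq> 0\<close> by (simp add: dunkl_term_def W_def \<xi>_def)
  have summable: "summable (\<lambda>i. W i * (\<xi> i - x)\<^sup>2)"
    using assms(10) \<open>C \<noteq> 0\<close> unfolding tm by (subst (asm) summable_cmult_iff) simp
  have K: "dunkl_K \<mu> c q n f x = (\<Sum>i. W i * f (\<xi> i))" if "summable (\<lambda>i. W i * f (\<xi> i))" for f
    unfolding dunkl_K_def C_def[symmetric] tm using suminf_mult[OF that, of C] \<open>C \<noteq> 0\<close> by simp
  have moment: "\<Omega>2 = (\<Sum>i. W i * (\<xi> i - x)\<^sup>2)"
    unfolding assms(11) by (rule K[OF summable])
  have nonneg: "0 \<le> W i * (\<xi> i - x)\<^sup>2" for i using W_nonneg by simp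
  have "\<Omega>2 \<ge> 0" unfolding moment by (intro suminf_nonneg summable nonneg)
  then have "s \<ge> 0" "s ^ 4 = \<Omega>2" by (auto simp: assms(12))
  then have second_moment: "(\<lambda>i. W i * (\<xi> i - x)\<^sup>2) sums s ^ 4"
    using summable moment by (simp add: summable_sums)
  have coeff: "3/4 * (2 + a + s\<^sup>2) > 0"
    using assms(8) zero_le_power2[of s] by (simp add: add_pos_nonneg)
  show ?thesis
  \<comment> \<open>If \<open>s = 0\<close>, all mass sits at nodes equal to \<open>x\<close>, so
    the operator reproduces \<open>\<psi> x\<close>; the interpolation argument needs a positive
    step.\<close>
  proof (cases "s = 0")
    case True
    then have "W i * (\<xi> i - x)\<^sup>2 = 0" for i
      using suminf_eq_zero_iff[OF summable nonneg] moment \<open>s ^ 4 = \<Omega>2\<close> by simp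
    then have "W i * \<psi> (\<xi> i) = W i * \<psi> x" for i
      by (metis eq_iff_diff_eq_0 mult_eq_0_iff power2_eq_square)
    then have "(\<lambda>i. W i * \<psi> (\<xi> i)) sums \<psi> x"
      using sums_mult2[OF W_sums, of "\<psi> x"] by (simp only: mult_1_left)
    then have "dunkl_K \<mu> c q n \<psi> x = \<psi> x"
      using K by (simp add: sums_iff)
    moreover have "0 \<le> ereal (3/4 * (2 + a + s\<^sup>2)) * modulus2 \<psi> s"
      using coeff modulus2_nonneg[OF \<open>s \<ge> 0\<close>] by (intro ereal_0_le_mult) auto
    \<comment> \<open>the sup norm may be infinite here, but \<open>0 * \<infinity> = 0\<close> in \<^typ>\<open>ereal\<close>\<close>
    ultimately show ?thesis using True by (simp flip: zero_ereal_def)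
  next
    case False
    then have "s > 0" using \<open>s \<ge> 0\<close> by simp
    show ?thesis
    \<comment> \<open>Both coefficients are positive now, so an infinite norm or modulus makes the
      right side infinite.\<close>
    proof (cases "sup_norm \<psi> = \<infinity> \<or> modulus2 \<psi> s = \<infinity>")
      case True
      have "0 \<le> ereal (3/4 * (2 + a + s\<^sup>2)) * modulus2 \<psi> s" "0 \<le> ereal (2 * s\<^sup>2 / a) * sup_norm \<psi>"
        using coeff modulus2_nonneg[OF \<open>s \<ge> 0\<close>] sup_norm_nonneg \<open>a > 0\<close>
        by (auto intro!: ereal_0_le_mult)
      moreover have "ereal (3/4 * (2 + a + s\<^sup>2)) * modulus2 \<psi> s = \<infinity> \<or> ereal (2 * s\<^sup>2 / a) * sup_norm \<psi> = \<infinity>"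
        using True coeff \<open>s > 0\<close> \<open>a > 0\<close> by (auto simp: ereal_mult_infty)
      ultimately show ?thesis by auto
    next
      case False
      then obtain M w where M: "sup_norm \<psi> = ereal M" and w: "modulus2 \<psi> s = ereal w"
        using ereal_exhaust_nonneg[OF sup_norm_nonneg] ereal_exhaust_nonneg[OF modulus2_nonneg[OF \<open>s \<ge> 0\<close>]]
        by metis
      have "second_difference_bound \<psi> s w"
      proof
        show "\<bar>\<psi> (y + d) - 2 * \<psi> y + \<psi> (y - d)\<bar> \<le> w" if "0 \<le> d" "d \<le> s" "0 \<le> y - d" for y d
          using modulus2_upper[OF that, of \<psi>] by (simp add: w)
      qed (fact assms(7) \<open>s > 0\<close>)+
      moreover have "\<bar>\<psi> t\<bar> \<le> M" if "0 \<le> t" for t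
        using sup_norm_upper[OF that, of \<psi>] by (simp add: M)
      ultimately have "summable (\<lambda>i. W i * \<psi> (\<xi> i))"
        "\<bar>(\<Sum>i. W i * \<psi> (\<xi> i)) - \<psi> x\<bar> \<le> 3/4 * (2 + a + s\<^sup>2) * w + 2 * s\<^sup>2 / a * M"
        using bounded_deviation[OF _ _ W_nonneg W_sums \<xi> second_moment \<open>a > 0\<close> x(1)] by blast+
      then show ?thesis by (simp add: K M w)
    qed
  qed
qed

end
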